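(* Let $\mathscr{H}$ be a complex Hilbert space and let $A\in\mathbb{B}(\mathscr{H})$. Then for every real number $r\geq 1$, $$w^{2r}(A)\leq \frac{1}{2}\big(w^r(A^2)+\|A\|^{2r}\big).$$
   Context: $\mathbb{B}(\mathscr{H})$ denotes the $C^*$-algebra of all bounded linear operators on the complex Hilbert space $\mathscr{H}$, and $\|\cdot\|$ is the operator norm. The numerical radius of $A\in\mathbb{B}(\mathscr{H})$ is $w(A)=\sup\{|\langle Ax,x\rangle| : x\in\mathscr{H},\ \|x\|=1\}$, and $w^s(A)$ means $(w(A))^s$. *)

theory Defs
  imports "HOL-Analysis.Analysis"
begin

class scaleC = scaleR +
  fixes scaleC :: "complex \<Rightarrow> 'a \<Rightarrow> 'a"  (infixr "*\<^sub>C" 75)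
  assumes scaleR_scaleC: "r *\<^sub>R x = complex_of_real r *\<^sub>C x"

class complex_vector = scaleC + ab_group_add +
  assumes scaleC_add_right: "a *\<^sub>C (x + y) = a *\<^sub>C x + a *\<^sub>C y"
    and scaleC_add_left: "(a + b) *\<^sub>C x = a *\<^sub>C x + b *\<^sub>C x"
    and scaleC_scaleC: "a *\<^sub>C (b *\<^sub>C x) = (a * b) *\<^sub>C x"
    and scaleC_one: "1 *\<^sub>C x = x"

text \<open>The inner product is linear in its first argument. The norm and the topology are those
  of the underlying real normed space, tied to the inner product by \<open>norm_eq_sqrt_cinner\<close>.\<close>

class complex_inner = complex_vector + real_normed_vector +
  fixes cinner :: "'a \<Rightarrow> 'a \<Rightarrow> complex"
  assumes cinner_commute: "cinner x y = cnj (cinner y x)"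
    and cinner_add_left: "cinner (x + y) z = cinner x z + cinner y z"
    and cinner_scaleC_left: "cinner (c *\<^sub>C x) y = c * cinner x y"
    and cinner_ge_zero: "0 \<le> Re (cinner x x)"
    and cinner_eq_zero_iff: "cinner x x = 0 \<longleftrightarrow> x = 0"
    and norm_eq_sqrt_cinner: "norm x = sqrt (Re (cinner x x))"

class chilbert_space = complex_inner + complete_space

instantiation complex :: chilbert_space
begin

definition scaleC_complex :: "complex \<Rightarrow> complex \<Rightarrow> complex"
  where "scaleC_complex c x = c * x"

definition cinner_complex :: "complex \<Rightarrow> complex \<Rightarrow> complex"
  where "cinner_complex x y = x * cnj y"

instance
proof
  fix x :: complex
  show "0 \<le> Re (cinner x x)"
    by (simp add: cinner_complex_def)
  show "norm x = sqrt (Re (cinner x x))"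
    by (simp add: cinner_complex_def cmod_def power2_eq_square)
qed (simp_all add: scaleC_complex_def cinner_complex_def scaleR_conv_of_real algebra_simps)

end

definition bounded_clinear :: "('a::complex_inner \<Rightarrow> 'b::complex_inner) \<Rightarrow> bool"
  where "bounded_clinear A \<longleftrightarrow>
    bounded_linear A \<and> (\<forall>c x. A (c *\<^sub>C x) = c *\<^sub>C A x)"

text \<open>The case distinction only matters for the zero space, which has no unit vectors: the
  supremum of the empty set of nonnegative numbers is taken to be \<open>0\<close>, whereas \<open>Sup {}\<close> is
  unspecified on the reals.\<close>

definition numerical_radius :: "('a::complex_inner \<Rightarrow> 'a) \<Rightarrow> real"
  where "numerical_radius A =
    (if \<exists>x::'a. norm x = 1 then SUP x\<in>{x. norm x = 1}. cmod (cinner (A x) x) else 0)"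

end

theory Submission
  imports Defs
begin

text \<open>
  The heart of the matter is the pointwise bound
  \<open>\<bar>\<langle>Ax, x\<rangle>\<bar>\<^sup>2 \<le> (\<bar>\<langle>A\<^sup>2x, x\<rangle>\<bar> + \<parallel>A\<parallel>\<^sup>2) / 2\<close> for unit vectors \<open>x\<close>. It is the instance
  \<open>a = Ax\<close>, \<open>b = A\<^sup>*x\<close> of Buzano's inequality
  \<open>2 \<bar>\<langle>a, x\<rangle>\<langle>x, b\<rangle>\<bar> \<le> \<bar>\<langle>a, b\<rangle>\<bar> + \<parallel>a\<parallel> \<parallel>b\<parallel>\<close>, weakened by \<open>\<parallel>A\<^sup>*x\<parallel> \<le> \<parallel>A\<parallel>\<close>.
  Buzano's inequality expresses that the reflection \<open>R z = 2\<langle>z, x\<rangle>x - z\<close> in the line through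
  \<open>x\<close> is an isometry (\<open>norm_reflection_in_line\<close>). Applying \<open>R\<close> to \<open>Ax\<close> gives the pointwise
  bound in terms of \<open>A\<close> alone (\<open>cinner_square_le\<close>): with \<open>\<lambda> = \<langle>Ax, x\<rangle>\<close>,
  \<open>\<langle>A(R(Ax)), x\<rangle> = 2\<lambda>\<^sup>2 - \<langle>A\<^sup>2x, x\<rangle>\<close>,
  while the left-hand side has modulus at most \<open>\<parallel>A\<parallel> \<parallel>R(Ax)\<parallel> = \<parallel>A\<parallel> \<parallel>Ax\<parallel> \<le> \<parallel>A\<parallel>\<^sup>2\<close>.

  Taking the supremum over \<open>x\<close> gives the case \<open>r = 1\<close>
  (\<open>numerical_radius_square_le\<close>). The general case follows from it because \<open>t \<mapsto> t powr r\<close> is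
  increasing and, for \<open>r \<ge> 1\<close>, convex on the nonnegative reals, so that the \<open>r\<close>-th power of a
  mean is at most the mean of the \<open>r\<close>-th powers (\<open>powr_midpoint_le\<close>).
\<close>

lemma cinner_diff_left:
  fixes x y z :: "'a::complex_inner"
  shows "cinner (x - y) z = cinner x z - cinner y z"
  using cinner_add_left[of "x - y" y z] by simp

lemma cinner_diff_right:
  fixes x y z :: "'a::complex_inner"
  shows "cinner z (x - y) = cinner z x - cinner z y"
  by (metis cinner_commute cinner_diff_left complex_cnj_diff)

lemma cinner_scaleC_right:
  fixes x y :: "'a::complex_inner"
  shows "cinner x (c *\<^sub>C y) = cnj c * cinner x y"
  by (metis cinner_commute cinner_scaleC_left complex_cnj_mult)

lemma cinner_self:
  fixes x :: "'a::complex_inner"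
  shows "cinner x x = of_real ((norm x)\<^sup>2)"
proof -
  have "Im (cinner x x) = 0"
    by (metis cinner_commute Reals_cnj_iff complex_is_Real_iff)
  then show ?thesis
    by (simp add: complex_eq_iff norm_eq_sqrt_cinner cinner_ge_zero)
qed

lemma norm_scaleC_diff_square:
  fixes x z :: "'a::complex_inner"
  assumes "norm x = 1"
  shows "(norm (c *\<^sub>C x - z))\<^sup>2
    = (norm z)\<^sup>2 + (cmod c)\<^sup>2 - 2 * Re (cnj c * cinner z x)"
proof -
  have "cinner x z = cnj (cinner z x)"
    by (rule cinner_commute)
  then have "cinner (c *\<^sub>C x - z) (c *\<^sub>C x - z)
    = c * cnj c - c * cnj (cinner z x) - cnj c * cinner z x + of_real ((norm z)\<^sup>2)"
    using assms
    by (simp add: cinner_diff_left cinner_diff_right cinner_scaleC_left cinner_scaleC_right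
        cinner_self[of x] cinner_self[of z] algebra_simps)
  then have "(norm (c *\<^sub>C x - z))\<^sup>2
    = Re (c * cnj c - c * cnj (cinner z x) - cnj c * cinner z x + of_real ((norm z)\<^sup>2))"
    by (metis cinner_self Re_complex_of_real)
  then show ?thesis
    unfolding cmod_power2 by (simp add: power2_eq_square)
qed

text \<open>The case \<open>c = \<langle>z, x\<rangle>\<close> of the expansion above is Pythagoras' theorem for the orthogonal
  projection onto the line through \<open>x\<close>.\<close>

lemma norm_cinner_unit_le:
  fixes x z :: "'a::complex_inner"
  assumes "norm x = 1"
  shows "cmod (cinner z x) \<le> norm z"
proof -
  have "(norm (cinner z x *\<^sub>C x - z))\<^sup>2 = (norm z)\<^sup>2 - (cmod (cinner z x))\<^sup>2"
    unfolding norm_scaleC_diff_square[OF assms] cmod_power2 by (simp add: power2_eq_square)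
  then have "(cmod (cinner z x))\<^sup>2 \<le> (norm z)\<^sup>2"
    by (metis diff_ge_0_iff_ge zero_le_power2)
  then show ?thesis
    by (rule power2_le_imp_le) simp
qed

lemma norm_reflection_in_line:
  fixes x z :: "'a::complex_inner"
  assumes "norm x = 1"
  shows "norm ((2 * cinner z x) *\<^sub>C x - z) = norm z"
proof -
  have "(norm ((2 * cinner z x) *\<^sub>C x - z))\<^sup>2 = (norm z)\<^sup>2"
    unfolding norm_scaleC_diff_square[OF assms] norm_mult power_mult_distrib cmod_power2
    by (simp add: power2_eq_square)
  then show ?thesis
    by simp
qed

lemma cinner_le_onorm:
  fixes A :: "'a::complex_inner \<Rightarrow> 'a"
  assumes "bounded_linear A" and "norm x = 1"
  shows "cmod (cinner (A z) x) \<le> onorm A * norm z"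
  using norm_cinner_unit_le[OF assms(2)] onorm[OF assms(1)] order_trans by blast

lemma cinner_square_le:
  fixes A :: "'a::complex_inner \<Rightarrow> 'a"
  assumes "bounded_clinear A" and x: "norm x = 1"
  shows "2 * (cmod (cinner (A x) x))\<^sup>2 \<le> cmod (cinner (A (A x)) x) + (onorm A)\<^sup>2"
proof -
  have lin: "bounded_linear A" and scale: "\<And>c y. A (c *\<^sub>C y) = c *\<^sub>C A y"
    using assms(1) unfolding bounded_clinear_def by auto
  define l where "l = cinner (A x) x"
  \<comment> \<open>The mirror image of \<open>A x\<close> in the line through \<open>x\<close>: it is as long as \<open>A x\<close>, and applying \<open>A\<close>
    brings \<open>l\<^sup>2\<close> and the quadratic form of \<open>A\<^sup>2\<close> together.\<close>
  let ?z = "(2 * l) *\<^sub>C x - A x"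
  have "A ?z = (2 * l) *\<^sub>C A x - A (A x)"
    using lin scale by (simp add: linear_diff bounded_linear.linear)
  then have image: "cinner (A ?z) x = 2 * l\<^sup>2 - cinner (A (A x)) x"
    by (simp add: cinner_diff_left cinner_scaleC_left l_def power2_eq_square)
  have "norm (A x) \<le> onorm A"
    using onorm[OF lin, of x] x by simp
  then have "norm ?z \<le> onorm A"
    unfolding l_def norm_reflection_in_line[OF x] .
  then have "cmod (cinner (A ?z) x) \<le> (onorm A)\<^sup>2"
    using cinner_le_onorm[OF lin x, of ?z] mult_left_mono[OF _ onorm_pos_le[OF lin]]
    unfolding power2_eq_square by (meson order_trans)
  moreover have "cmod (2 * l\<^sup>2) \<le> cmod (cinner (A (A x)) x) + cmod (cinner (A ?z) x)"
    unfolding image by (metis norm_triangle_sub)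
  ultimately show ?thesis
    by (simp add: norm_mult norm_power l_def)
qed

lemma cinner_le_numerical_radius:
  fixes A :: "'a::complex_inner \<Rightarrow> 'a"
  assumes "bounded_linear A" and "norm x = 1"
  shows "cmod (cinner (A x) x) \<le> numerical_radius A"
proof -
  \<comment> \<open>A supremum of reals dominates its members only when they are bounded above.\<close>
  have "cmod (cinner (A y) y) \<le> onorm A" if "norm y = 1" for y
    using cinner_le_onorm[OF assms(1) that, of y] that by simp
  then have "bdd_above ((\<lambda>y. cmod (cinner (A y) y)) ` {y. norm y = 1})"
    by (intro bdd_aboveI2[where M = "onorm A"]) auto
  then have "cmod (cinner (A x) x) \<le> (SUP y\<in>{y. norm y = 1}. cmod (cinner (A y) y))"
    using assms(2) by (intro cSUP_upper) auto
  then show ?thesis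
    using assms(2) unfolding numerical_radius_def by auto
qed

text \<open>The sign condition on the bound is for the zero space, where no unit vector supplies it and
  the numerical radius is \<open>0\<close>.\<close>

lemma numerical_radius_le:
  fixes A :: "'a::complex_inner \<Rightarrow> 'a"
  assumes "\<And>x. norm x = 1 \<Longrightarrow> cmod (cinner (A x) x) \<le> b" and "0 \<le> b"
  shows "numerical_radius A \<le> b"
  unfolding numerical_radius_def using assms by (auto intro!: cSUP_least)

lemma numerical_radius_nonneg:
  fixes A :: "'a::complex_inner \<Rightarrow> 'a"
  assumes "bounded_linear A"
  shows "0 \<le> numerical_radius A"
proof (cases "\<exists>x::'a. norm x = 1")
  case True
  then show ?thesis
    using cinner_le_numerical_radius[OF assms] norm_ge_zero order_trans by blast
next
  case False
  then show ?thesis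
    by (simp add: numerical_radius_def)
qed

lemma bounded_linear_square:
  assumes "bounded_linear A"
  shows "bounded_linear (A \<circ> A)"
  using bounded_linear_compose[OF assms assms] by (simp add: comp_def)

lemma numerical_radius_square_le:
  fixes A :: "'a::complex_inner \<Rightarrow> 'a"
  assumes "bounded_clinear A"
  shows "(numerical_radius A)\<^sup>2 \<le> (numerical_radius (A \<circ> A) + (onorm A)\<^sup>2) / 2"
    (is "_ \<le> ?m")
proof -
  have lin: "bounded_linear A"
    using assms unfolding bounded_clinear_def by simp
  note lin2 = bounded_linear_square[OF lin]
  have m: "0 \<le> ?m"
    using numerical_radius_nonneg[OF lin2] by simp
  have "cmod (cinner (A x) x) \<le> sqrt ?m" if "norm x = 1" for x
  proof (rule real_le_rsqrt)
    show "(cmod (cinner (A x) x))\<^sup>2 \<le> ?m"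
      using cinner_square_le[OF assms that] cinner_le_numerical_radius[OF lin2 that] by simp
  qed
  then have "numerical_radius A \<le> sqrt ?m"
    using m by (intro numerical_radius_le) auto
  then have "(numerical_radius A)\<^sup>2 \<le> (sqrt ?m)\<^sup>2"
    using numerical_radius_nonneg[OF lin] by (rule power_mono)
  then show ?thesis
    using m by simp
qed

lemma powr_midpoint_le:
  fixes a b r :: real
  assumes "0 \<le> a" and "0 \<le> b" and "1 \<le> r"
  shows "((a + b) / 2) powr r \<le> (a powr r + b powr r) / 2"
proof -
  \<comment> \<open>Convexity covers only positive arguments; at a zero argument the claim is
    \<open>2 \<le> 2 powr r\<close>.\<close>
  have half: "(t / 2) powr r \<le> t powr r / 2" if "0 \<le> t" for t :: real
  proof -
    have "2 powr 1 \<le> (2::real) powr r"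
      using assms(3) by (intro powr_mono) auto
    then have "t powr r / 2 powr r \<le> t powr r / 2"
      by (intro divide_left_mono) auto
    then show ?thesis
      using that by (simp add: powr_divide)
  qed
  consider "a = 0" | "b = 0" | "0 < a" "0 < b"
    using assms(1,2) by linarith
  then show ?thesis
  proof cases
    case 1
    then show ?thesis using half[OF assms(2)] by simp
  next
    case 2
    then show ?thesis using half[OF assms(1)] by simp
  next
    case 3
    then have "((1 - 1 / 2) *\<^sub>R a + (1 / 2) *\<^sub>R b) powr r
      \<le> (1 - 1 / 2) * a powr r + 1 / 2 * b powr r"
      by (intro convex_onD[OF powr_convex[OF assms(3)]]) auto
    then show ?thesis by (simp add: add_divide_distrib)
  qed
qed

theorem theorem2p4:
  fixes A :: "'a::chilbert_space \<Rightarrow> 'a" and r :: real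
  assumes "bounded_clinear A" and "r \<ge> 1"
  shows "numerical_radius A powr (2 * r)
    \<le> 1 / 2 * (numerical_radius (A \<circ> A) powr r + onorm A powr (2 * r))"
proof -
  have lin: "bounded_linear A"
    using assms(1) unfolding bounded_clinear_def by simp
  have powr_double: "t powr (2 * r) = (t\<^sup>2) powr r" if "0 \<le> t" for t :: real
    using that by (simp add: powr_powr[symmetric] powr_numeral)
  have "numerical_radius A powr (2 * r) = ((numerical_radius A)\<^sup>2) powr r"
    by (rule powr_double) (rule numerical_radius_nonneg[OF lin])
  also have "\<dots> \<le> ((numerical_radius (A \<circ> A) + (onorm A)\<^sup>2) / 2) powr r"
    using numerical_radius_square_le[OF assms(1)] assms(2) by (intro powr_mono2) auto
  also have "\<dots> \<le> (numerical_radius (A \<circ> A) powr r + ((onorm A)\<^sup>2) powr r) / 2"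
    using numerical_radius_nonneg[OF bounded_linear_square[OF lin]] assms(2)
    by (intro powr_midpoint_le) auto
  also have "((onorm A)\<^sup>2) powr r = onorm A powr (2 * r)"
    by (rule powr_double[symmetric]) (rule onorm_pos_le[OF lin])
  finally show ?thesis
    by (simp del: o_apply add: mult.commute)
qed

end
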